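(* If a symmetric $0,1$-matrix $M$ does not admit a $k$-wide division, then $\mathrm{stw}(M)\leq 32(k+1)^3$.
   Context: Let $M$ be a symmetric $n\times n$ $0,1$-matrix with rows $r_1,\dots,r_n$ and columns $c_1,\dots,c_n$. A symmetric partition of $M$ is a pair $(\mathcal R,\mathcal C)$ with $\mathcal R$ a partition of the rows and $\mathcal C$ a partition of the columns such that $r_i,r_j$ lie in the same part iff $c_i,c_j$ do; each row part $R$ has a symmetric column part. The zone $R\cap C$ is the submatrix with rows $R$ and columns $C$; it is non-constant if it contains two distinct entries. A symmetric partition sequence of $M$ is a sequence of symmetric partitions starting with the partition into singletons, ending with one row part and one column part, each obtained from the previous one by merging two row parts and the two symmetric column parts. The span of a set of columns (rows) is the set of columns (rows) with index between its minimum and maximum index; two sets conflict if their spans intersect. The stretch value of a row part $R$ is the number of column parts conflicting with the union of all column parts $C$ such that $C$ is the symmetric of $R$ or $R\cap C$ is non-constant; symmetrically for column parts; the stretch value of a partition is the maximum over its parts. $\mathrm{stw}(M)$ is the minimum over symmetric partition sequences of the maximum stretch value of a partition in the sequence. A division is a symmetric partition whose parts consist of consecutive rows (columns), written $(R_1,\dots,R_p)$, $(C_1,\dots,C_p)$ in order. A row part $R_i$ is $k$-wide if for every $k$ consecutive column parts $C_j,\dots,C_{j+k-1}$ with $j\le i\le j+k-1$, the submatrix with rows $R_i$ and all columns outside $C_j\cup\dots\cup C_{j+k-1}$ has at least $k$ distinct rows; symmetrically for column parts. A division is $k$-wide if all its row and column parts are $k$-wide. *)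

theory Defs
  imports "Jordan_Normal_Form.Matrix" "HOL-Library.Disjoint_Sets"
begin

text \<open>Rows and columns are represented by their indices, counted from \<open>0\<close>. In a symmetric
  partition (R, C) the column part symmetric to a row part X is the one with the same set of
  indices, i.e. X itself read as a set of columns (cf. \<open>symmetric_partition_eq\<close>).\<close>

definition zero_one_matrix :: "'a::zero_neq_one mat \<Rightarrow> bool" where
  "zero_one_matrix M \<longleftrightarrow> (\<forall>i<dim_row M. \<forall>j<dim_col M. M $$ (i, j) \<in> {0, 1})"

type_synonym parts = "nat set set"

definition symmetric_partition :: "'a mat \<Rightarrow> parts \<times> parts \<Rightarrow> bool" where
  "symmetric_partition M = (\<lambda>(R, C).
     partition_on {..<dim_row M} R \<and> partition_on {..<dim_col M} C \<and>
     (\<forall>i<dim_row M. \<forall>j<dim_row M. (\<exists>X\<in>R. i \<in> X \<and> j \<in> X) \<longleftrightarrow> (\<exists>Y\<in>C. i \<in> Y \<and> j \<in> Y)))"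

definition nonconstant_zone :: "'a mat \<Rightarrow> nat set \<Rightarrow> nat set \<Rightarrow> bool" where
  "nonconstant_zone M X Y \<longleftrightarrow>
     (\<exists>i\<in>X. \<exists>j\<in>Y. \<exists>i'\<in>X. \<exists>j'\<in>Y. M $$ (i, j) \<noteq> M $$ (i', j'))"

definition merge_step :: "parts \<times> parts \<Rightarrow> parts \<times> parts \<Rightarrow> bool" where
  "merge_step = (\<lambda>(R, C) (R', C').
     \<exists>X\<in>R. \<exists>Y\<in>R. X \<noteq> Y \<and>
       R' = insert (X \<union> Y) (R - {X, Y}) \<and> C' = insert (X \<union> Y) (C - {X, Y}))"

definition symmetric_partition_sequence :: "'a mat \<Rightarrow> (parts \<times> parts) list \<Rightarrow> bool" where
  "symmetric_partition_sequence M S \<longleftrightarrow>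
     S \<noteq> [] \<and> (\<forall>P\<in>set S. symmetric_partition M P) \<and>
     hd S = ((\<lambda>i. {i}) ` {..<dim_row M}, (\<lambda>j. {j}) ` {..<dim_col M}) \<and>
     card (fst (last S)) = 1 \<and> card (snd (last S)) = 1 \<and>
     successively merge_step S"

definition span_of :: "nat set \<Rightarrow> nat set" where
  "span_of X = {Min X..Max X}"

definition in_conflict :: "nat set \<Rightarrow> nat set \<Rightarrow> bool" where
  "in_conflict X Y \<longleftrightarrow> span_of X \<inter> span_of Y \<noteq> {}"

definition row_stretch :: "'a mat \<Rightarrow> parts \<Rightarrow> nat set \<Rightarrow> nat" where
  "row_stretch M C X =
     card {Y\<in>C. in_conflict Y (\<Union>{Z\<in>C. Z = X \<or> nonconstant_zone M X Z})}"

definition col_stretch :: "'a mat \<Rightarrow> parts \<Rightarrow> nat set \<Rightarrow> nat" where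
  "col_stretch M R Y =
     card {X\<in>R. in_conflict X (\<Union>{Z\<in>R. Z = Y \<or> nonconstant_zone M Z Y})}"

definition stretch_value :: "'a mat \<Rightarrow> parts \<times> parts \<Rightarrow> nat" where
  "stretch_value M = (\<lambda>(R, C). Max (row_stretch M C ` R \<union> col_stretch M R ` C))"

text \<open>The infimum below is a minimum for every square matrix with at least one row, by
  \<open>symmetric_partition_sequence_exists\<close>.\<close>

definition stw :: "'a mat \<Rightarrow> nat" where
  "stw M = (INF S\<in>{S. symmetric_partition_sequence M S}. Max (stretch_value M ` set S))"

definition ordered_parts :: "nat set list \<Rightarrow> bool" where
  "ordered_parts Xs \<longleftrightarrow>
     (\<forall>X\<in>set Xs. \<exists>a b. X = {a..b}) \<and> sorted_wrt (\<lambda>X Y. \<forall>x\<in>X. \<forall>y\<in>Y. x < y) Xs"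

definition division :: "'a mat \<Rightarrow> nat set list \<Rightarrow> nat set list \<Rightarrow> bool" where
  "division M Rs Cs \<longleftrightarrow>
     symmetric_partition M (set Rs, set Cs) \<and> ordered_parts Rs \<and> ordered_parts Cs"

definition distinct_rows :: "'a mat \<Rightarrow> nat set \<Rightarrow> nat set \<Rightarrow> nat" where
  "distinct_rows M X Y = card ((\<lambda>i. \<lambda>j\<in>Y. M $$ (i, j)) ` X)"

definition distinct_cols :: "'a mat \<Rightarrow> nat set \<Rightarrow> nat set \<Rightarrow> nat" where
  "distinct_cols M X Y = card ((\<lambda>j. \<lambda>i\<in>X. M $$ (i, j)) ` Y)"

text \<open>The union of the \<open>k\<close> consecutive parts starting at index \<open>j\<close>. Windows may run past the
  last part and are then cut off. If there are at least \<open>k\<close> parts, every cut-off window extends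
  to a full one, so nothing changes (\<open>row_wide_iff\<close>). If there are fewer than \<open>k > 1\<close>
  parts, quantifying over full windows only would be vacuous and make the division into a single
  part \<open>k\<close>-wide; with cut-off windows, no part is \<open>k\<close>-wide in that case
  (\<open>not_row_wide\<close>).\<close>

definition window :: "nat set list \<Rightarrow> nat \<Rightarrow> nat \<Rightarrow> nat set" where
  "window Xs k j = \<Union>(set (take k (drop j Xs)))"

definition row_wide :: "'a mat \<Rightarrow> nat \<Rightarrow> nat set list \<Rightarrow> nat set list \<Rightarrow> nat \<Rightarrow> bool" where
  "row_wide M k Rs Cs i \<longleftrightarrow>
     (\<forall>j. j \<le> i \<and> i < j + k \<longrightarrow>
        k \<le> distinct_rows M (Rs ! i) ({..<dim_col M} - window Cs k j))"

definition col_wide :: "'a mat \<Rightarrow> nat \<Rightarrow> nat set list \<Rightarrow> nat set list \<Rightarrow> nat \<Rightarrow> bool" where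
  "col_wide M k Rs Cs i \<longleftrightarrow>
     (\<forall>j. j \<le> i \<and> i < j + k \<longrightarrow>
        k \<le> distinct_cols M ({..<dim_row M} - window Rs k j) (Cs ! i))"

definition wide_division :: "'a mat \<Rightarrow> nat \<Rightarrow> nat set list \<Rightarrow> nat set list \<Rightarrow> bool" where
  "wide_division M k Rs Cs \<longleftrightarrow>
     division M Rs Cs \<and>
     (\<forall>i<length Rs. row_wide M k Rs Cs i) \<and> (\<forall>i<length Cs. col_wide M k Rs Cs i)"


lemma symmetric_partition_eq:
  assumes "symmetric_partition M (R, C)" "dim_row M = dim_col M"
  shows "R = C"
proof -
  have sub: "P \<subseteq> Q" if P: "partition_on A P" and Q: "partition_on A Q"
    and e: "\<And>i j. i \<in> A \<Longrightarrow> j \<in> A \<Longrightarrow> (\<exists>X\<in>P. i \<in> X \<and> j \<in> X) \<longleftrightarrow> (\<exists>Y\<in>Q. i \<in> Y \<and> j \<in> Y)"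
    for A :: "nat set" and P Q
  proof
    fix X assume X: "X \<in> P"
    then obtain i where i: "i \<in> X" using P by (metis all_not_in_conv partition_onD3)
    have iA: "i \<in> A" using P X i by (auto simp: partition_on_def)
    then obtain Y where Y: "Y \<in> Q" "i \<in> Y" using Q by (auto simp: partition_on_def)
    have uX: "X' = X" if "X' \<in> P" "i \<in> X'" for X'
      using P X i that by (auto simp: partition_on_def disjoint_def)
    have uY: "Y' = Y" if "Y' \<in> Q" "i \<in> Y'" for Y'
      using Q Y that by (auto simp: partition_on_def disjoint_def)
    have XA: "X \<subseteq> A" and YA: "Y \<subseteq> A" using P Q X Y by (auto simp: partition_on_def)
    have "j \<in> X \<longleftrightarrow> j \<in> Y" if "j \<in> A" for j
      using e[OF iA that] uX uY X Y i by metis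
    then show "X \<in> Q" using XA YA Y by (metis subset_antisym subset_iff)
  qed
  show ?thesis
    using assms sub[of "{..<dim_row M}" R C] sub[of "{..<dim_row M}" C R]
    by (auto simp: symmetric_partition_def)
qed

lemma distinct_rows_mono:
  assumes "finite X" "Y \<subseteq> Y'"
  shows "distinct_rows M X Y \<le> distinct_rows M X Y'"
proof -
  have "(\<lambda>i. \<lambda>j\<in>Y. M $$ (i, j)) ` X = (\<lambda>f. restrict f Y) ` (\<lambda>i. \<lambda>j\<in>Y'. M $$ (i, j)) ` X"
    using assms(2) by (force simp: image_image restrict_def fun_eq_iff intro!: image_cong)
  then show ?thesis
    unfolding distinct_rows_def using assms(1) by (simp add: card_image_le)
qed

lemma row_wide_iff:
  assumes "k \<le> length Cs" "i < length Cs" "finite (Rs ! i)"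
  shows "row_wide M k Rs Cs i \<longleftrightarrow>
    (\<forall>j. j + k \<le> length Cs \<and> j \<le> i \<and> i < j + k \<longrightarrow>
        k \<le> distinct_rows M (Rs ! i) ({..<dim_col M} - \<Union>{Cs ! l |l. j \<le> l \<and> l < j + k}))"
    (is "?L \<longleftrightarrow> ?R")
proof -
  have win: "window Cs k j = \<Union>{Cs ! l |l. j \<le> l \<and> l < j + k \<and> l < length Cs}" for j
  proof -
    have "set (take k (drop j Cs)) = {Cs ! l |l. j \<le> l \<and> l < j + k \<and> l < length Cs}"
    proof (intro equalityI subsetI)
      fix X assume "X \<in> set (take k (drop j Cs))"
      then obtain m where "m < k" "j + m < length Cs" "X = Cs ! (j + m)"
        by (auto simp: in_set_conv_nth)
      then show "X \<in> {Cs ! l |l. j \<le> l \<and> l < j + k \<and> l < length Cs}" by force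
    next
      fix X assume "X \<in> {Cs ! l |l. j \<le> l \<and> l < j + k \<and> l < length Cs}"
      then obtain l where l: "j \<le> l" "l < j + k" "l < length Cs" "X = Cs ! l" by auto
      then have "X = take k (drop j Cs) ! (l - j)" "l - j < length (take k (drop j Cs))" by auto
      then show "X \<in> set (take k (drop j Cs))" by (metis nth_mem)
    qed
    then show ?thesis by (simp add: window_def)
  qed
  have full: "window Cs k j = \<Union>{Cs ! l |l. j \<le> l \<and> l < j + k}" if "j + k \<le> length Cs" for j
    unfolding win using that by (metis order_less_le_trans)
  show ?thesis
  proof
    assume ?L then show ?R by (auto simp: row_wide_def full)
  next
    assume R: ?R
    show ?L unfolding row_wide_def
    proof (intro allI impI)
      fix j assume j: "j \<le> i \<and> i < j + k"
      define j' where "j' = min j (length Cs - k)"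
      have j': "j' + k \<le> length Cs" "j' \<le> i" "i < j' + k" "j' \<le> j"
        using assms j by (auto simp: j'_def)
      have "window Cs k j \<subseteq> window Cs k j'"
      proof -
        have "j' \<le> l \<and> l < j' + k" if "j \<le> l \<and> l < j + k \<and> l < length Cs" for l
          using that assms(1) by (auto simp: j'_def)
        then have "{Cs ! l |l. j \<le> l \<and> l < j + k \<and> l < length Cs}
            \<subseteq> {Cs ! l |l. j' \<le> l \<and> l < j' + k \<and> l < length Cs}" by blast
        then show ?thesis unfolding win by (rule Union_mono)
      qed
      moreover have "k \<le> distinct_rows M (Rs ! i) ({..<dim_col M} - window Cs k j')"
        using R[rule_format, of j'] j' full[of j'] by presburger
      ultimately show "k \<le> distinct_rows M (Rs ! i) ({..<dim_col M} - window Cs k j)"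
        using distinct_rows_mono[OF assms(3)] by (meson Diff_mono order_refl order_trans)
    qed
  qed
qed

lemma not_row_wide:
  assumes "symmetric_partition M (R, set Cs)" "length Cs \<le> k" "2 \<le> k" "i < k"
  shows "\<not> row_wide M k Rs Cs i"
proof
  assume "row_wide M k Rs Cs i"
  then have "k \<le> distinct_rows M (Rs ! i) ({..<dim_col M} - window Cs k 0)"
    using assms by (auto simp: row_wide_def)
  moreover have "{..<dim_col M} - window Cs k 0 = {}"
    using assms by (auto simp: window_def symmetric_partition_def partition_on_def)
  moreover have "distinct_rows M (Rs ! i) {} \<le> 1"
  proof -
    have "(\<lambda>r. \<lambda>j\<in>{}. M $$ (r, j)) ` (Rs ! i) \<subseteq> {\<lambda>_. undefined}" by auto
    then show ?thesis
      unfolding distinct_rows_def by (metis card_mono card.empty card_insert_disjoint empty_iff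
          finite.emptyI finite.insertI One_nat_def)
  qed
  ultimately show False using assms(3) by simp
qed

lemma symmetric_partition_sequence_exists:
  assumes "M \<in> carrier_mat n n" "n > 0"
  shows "\<exists>S. symmetric_partition_sequence M S"
proof -
  define P where "P m = insert {..m} ((\<lambda>i. {i}) ` {m<..<n})" for m
  define S where "S = map (\<lambda>m. (P m, P m)) [0..<n]"
  have part: "partition_on {..<n} (P m)" if "m < n" for m
    using that by (auto simp: P_def partition_on_def disjoint_def)
  have step: "merge_step (P m, P m) (P (Suc m), P (Suc m))" if "Suc m < n" for m
  proof -
    have "{..m} \<noteq> {Suc m}" by auto
    moreover have "{..m} \<in> P m" "{Suc m} \<in> P m" using that by (auto simp: P_def)
    moreover have "P (Suc m) = insert ({..m} \<union> {Suc m}) (P m - {{..m}, {Suc m}})"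
    proof -
      have "{..Suc m} = {..m} \<union> {Suc m}" by auto
      moreover have "{m<..<n} = insert (Suc m) {Suc m<..<n}" using that by auto
      moreover have "{..m} \<notin> (\<lambda>i. {i}) ` {Suc m<..<n}"
      proof
        assume "{..m} \<in> (\<lambda>i. {i}) ` {Suc m<..<n}"
        then obtain i where "{..m} = {i}" "Suc m < i" by auto
        moreover have "m \<in> {..m}" by simp
        ultimately show False by (metis Suc_lessD less_irrefl singletonD)
      qed
      moreover have "{Suc m} \<notin> (\<lambda>i. {i}) ` {Suc m<..<n}" by auto
      ultimately show ?thesis unfolding P_def by (simp add: insert_Diff_if)
    qed
    ultimately show ?thesis
      unfolding merge_step_def prod.case by (intro bexI[of _ "{..m}"] bexI[of _ "{Suc m}"] conjI)
  qed
  have "symmetric_partition M Q" if "Q \<in> set S" for Q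
    using that assms part by (auto simp: S_def symmetric_partition_def)
  moreover have "hd S = ((\<lambda>i. {i}) ` {..<n}, (\<lambda>i. {i}) ` {..<n})"
  proof -
    have "{..<n} = insert 0 {0<..<n}" using assms(2) by auto
    then have "P 0 = (\<lambda>i. {i}) ` {..<n}" by (simp add: P_def)
    then show ?thesis using assms(2) by (simp add: S_def hd_map)
  qed
  moreover have "last S = ({{..n - 1}}, {{..n - 1}})"
  proof -
    have "{n - 1<..<n} = {}" by auto
    then have "P (n - 1) = {{..n - 1}}" unfolding P_def by simp
    then show ?thesis using assms(2) by (simp add: S_def last_map)
  qed
  moreover have "successively merge_step S"
    unfolding S_def successively_conv_nth using step by auto
  ultimately have "symmetric_partition_sequence M S"
    using assms by (auto simp: symmetric_partition_sequence_def S_def)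
  then show ?thesis ..
qed

end

theory Submission
  imports Defs
begin

text \<open>Start from the division into singletons and merge consecutive parts as long as every part
  keeps fewer than \<open>k\<close> distinct rows outside the columns of the parts at distance less than
  \<open>2 k\<close>. If this got stuck with at least two parts, pairing up consecutive parts would give a
  \<open>k\<close>-wide division, so it ends with a single part. Now split each part of each of these
  divisions into the classes of rows that agree outside the nearby columns. The classes coarsen
  along the sequence of divisions, and by symmetry two classes in parts at distance at least
  \<open>2 k\<close> span a constant zone. Hence a set counted by the stretch value stays within
  \<open>4 k\<close> levels of at most \<open>k\<close> classes each, giving the stronger bound
  \<open>4 k\<^sup>2\<close>.\<close>

section \<open>Refining a partition by successive merges\<close>

text \<open>One-sided form of \<open>merge_step\<close>: the row and column partitions of a
  symmetric partition consist of the same index sets, so the construction follows a single partition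
  and is doubled only at the end.\<close>

definition merge_parts :: "'a set set \<Rightarrow> 'a set set \<Rightarrow> bool" where
  "merge_parts P Q \<longleftrightarrow> (\<exists>X\<in>P. \<exists>Y\<in>P. X \<noteq> Y \<and> Q = insert (X \<union> Y) (P - {X, Y}))"

lemma partition_on_merge:
  assumes "partition_on A P" "X \<in> P" "Y \<in> P"
  shows "partition_on A (insert (X \<union> Y) (P - {X, Y}))"
proof (rule partition_onI)
  show "\<Union> (insert (X \<union> Y) (P - {X, Y})) = A"
    using assms partition_onD1[OF assms(1)] by blast
  show "{} \<notin> insert (X \<union> Y) (P - {X, Y})"
    using assms partition_onD3[OF assms(1)] by auto
  have "Z \<inter> Z' = {}" if "Z \<in> P" "Z' \<in> P" "Z \<noteq> Z'" for Z Z'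
    using partition_onD2[OF assms(1)] that by (auto dest: disjointD)
  then show "disjnt Z Z'" if "Z \<in> insert (X \<union> Y) (P - {X, Y})"
    "Z' \<in> insert (X \<union> Y) (P - {X, Y})" "Z \<noteq> Z'" for Z Z'
    using that assms(2,3) unfolding disjnt_def by (auto simp: Int_Un_distrib Int_Un_distrib2)
qed

lemma partition_on_part_eq:
  assumes "partition_on A P" "X \<in> P" "Y \<in> P" "x \<in> X" "x \<in> Y"
  shows "X = Y"
  using disjointD[OF partition_onD2[OF assms(1)] assms(2,3)] assms(4,5) by blast

text \<open>If no part of \<open>Q\<close> contains two parts of \<open>P\<close>, then each part of
  \<open>Q\<close>, being a union of parts of \<open>P\<close>, is itself one of them.
  Contrapositively, a proper refinement offers two parts of \<open>P\<close> to merge inside one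
  part of \<open>Q\<close>.\<close>

lemma refines_eqI:
  assumes "refines A P Q"
    and inj: "\<And>X X' Y. X \<in> P \<Longrightarrow> X' \<in> P \<Longrightarrow> Y \<in> Q \<Longrightarrow> X \<subseteq> Y \<Longrightarrow> X' \<subseteq> Y \<Longrightarrow> X = X'"
  shows "P = Q"
proof -
  have PQ: "partition_on A P" "partition_on A Q" "\<And>X. X \<in> P \<Longrightarrow> \<exists>Y\<in>Q. X \<subseteq> Y"
    using assms(1) by (auto simp: refines_def)
  have eq: "X = Y" if XY: "X \<in> P" "Y \<in> Q" "X \<subseteq> Y" for X Y
  proof
    show "Y \<subseteq> X"
    proof
      fix y assume y: "y \<in> Y"
      then obtain X' where X': "X' \<in> P" "y \<in> X'"
        using PQ(1,2) XY(2) by (auto simp: partition_on_def)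
      then obtain Y' where Y': "Y' \<in> Q" "X' \<subseteq> Y'" using PQ(3) by blast
      then have "Y' = Y" using partition_on_part_eq[OF PQ(2)] XY(2) X' y by blast
      then show "y \<in> X" using inj[OF XY(1) X'(1) XY(2,3)] Y' X' by blast
    qed
  qed (fact XY(3))
  have "P \<subseteq> Q" using eq PQ(3) by blast
  moreover have "Q \<subseteq> P"
  proof
    fix Y assume Y: "Y \<in> Q"
    then obtain y where y: "y \<in> Y" using PQ(2) by (metis all_not_in_conv partition_onD3)
    then obtain X where X: "X \<in> P" "y \<in> X" using PQ(1,2) Y by (auto simp: partition_on_def)
    then obtain Y' where "Y' \<in> Q" "X \<subseteq> Y'" using PQ(3) by blast
    then show "Y \<in> P" using eq[of X Y'] partition_on_part_eq[OF PQ(2)] X Y y by blast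
  qed
  ultimately show ?thesis by blast
qed

text \<open>Merging two parts of \<open>P\<close> inside a common part of \<open>Q\<close> stays
  between \<open>P\<close> and \<open>Q\<close> and lowers the number of parts, so iteration reaches
  \<open>Q\<close>. Carrying \<open>ok\<close> at both ends of each step preserves it when paths are
  concatenated.\<close>

lemma refines_merge_path:
  assumes "finite A" "refines A P Q"
    and "\<And>T. refines A P T \<Longrightarrow> refines A T Q \<Longrightarrow> ok T"
  shows "(\<lambda>T T'. merge_parts T T' \<and> ok T \<and> ok T')\<^sup>*\<^sup>* P Q"
  using assms(2,3)
proof (induction "card P" arbitrary: P rule: less_induct)
  case less
  have ref: "refines A P Q" by fact
  then have P: "partition_on A P" and Q: "partition_on A Q" by (auto simp: refines_def)
  show ?case
  proof (cases "P = Q")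
    case False
    then obtain X X' Y where X: "X \<in> P" "X' \<in> P" "Y \<in> Q" "X \<subseteq> Y" "X' \<subseteq> Y" "X \<noteq> X'"
      using refines_eqI[OF ref] by metis
    define T where "T = insert (X \<union> X') (P - {X, X'})"
    have T: "partition_on A T" unfolding T_def by (rule partition_on_merge[OF P X(1,2)])
    have "\<exists>W\<in>T. Z \<subseteq> W" if "Z \<in> P" for Z
      using that unfolding T_def by (cases "Z = X \<or> Z = X'") auto
    then have PT: "refines A P T" using P T by (simp add: refines_def)
    have "\<exists>W\<in>Q. Z \<subseteq> W" if "Z \<in> T" for Z
      using that ref X(3-5) unfolding T_def by (cases "Z = X \<union> X'") (auto simp: refines_def)
    then have TQ: "refines A T Q" using T Q by (simp add: refines_def)
    have fin: "finite P" by (rule finite_elements[OF assms(1) P])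
    have "card T \<le> Suc (card (P - {X, X'}))" unfolding T_def by (rule card_insert_le_m1) (use fin in auto)
    moreover have "card (P - {X, X'}) + 2 = card P"
    proof -
      have "card {X, X'} = 2" using X by simp
      moreover have "card {X, X'} \<le> card P" by (rule card_mono) (use fin X in auto)
      ultimately show ?thesis using X by (simp add: card_Diff_subset)
    qed
    ultimately have "card T < card P" by linarith
    moreover have "ok U" if "refines A T U" "refines A U Q" for U
      using less.prems(2) refines_trans[OF PT that(1)] that(2) by blast
    ultimately have "(\<lambda>T T'. merge_parts T T' \<and> ok T \<and> ok T')\<^sup>*\<^sup>* T Q"
      using less.hyps[of T] TQ by blast
    moreover have "merge_parts P T" using X unfolding merge_parts_def T_def by blast
    moreover have "ok P" "ok T"
      using less.prems(2)[of P] less.prems(2)[of T] ref TQ PT refines_refl[OF P] by blast+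
    ultimately show ?thesis by (simp add: converse_rtranclp_into_rtranclp)
  qed simp
qed

text \<open>Turns a path into the list form of partition sequences; \<open>ok b\<close> covers the
  path of length zero.\<close>

lemma rtranclp_successively_list:
  assumes "(\<lambda>x y. r x y \<and> ok x \<and> ok y)\<^sup>*\<^sup>* a b" "ok b"
  obtains xs where "xs \<noteq> []" "hd xs = a" "last xs = b" "successively r xs" "\<forall>x\<in>set xs. ok x"
proof -
  have "\<exists>xs. xs \<noteq> [] \<and> hd xs = a \<and> last xs = b \<and> successively r xs \<and> (\<forall>x\<in>set xs. ok x)"
    using assms(1)
  proof (induction rule: converse_rtranclp_induct)
    case base
    show ?case using assms(2) by (intro exI[of _ "[b]"]) simp
  next
    case (step y z)
    then obtain xs where "xs \<noteq> []" "hd xs = z" "last xs = b" "successively r xs" "\<forall>x\<in>set xs. ok x"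
      by blast
    then show ?case using step by (intro exI[of _ "y # xs"]) (simp add: successively_Cons)
  qed
  then show thesis using that by blast
qed

section \<open>Divisions as level functions\<close>

text \<open>A division with \<open>p\<close> parts is encoded by the map sending each index to the position of its
  part, so that coarsening a division is composition with a monotone map.\<close>

definition level_fun :: "nat \<Rightarrow> nat \<Rightarrow> (nat \<Rightarrow> nat) \<Rightarrow> bool" where
  "level_fun n p d \<longleftrightarrow> mono_on {..<n} d \<and> d ` {..<n} = {..<p}"

definition level :: "nat \<Rightarrow> (nat \<Rightarrow> nat) \<Rightarrow> nat \<Rightarrow> nat set" where
  "level n d v = {x. x < n \<and> d x = v}"

text \<open>The columns outside the band of levels at distance at most \<open>w\<close> from
  \<open>v\<close>; sums replace differences to avoid truncated subtraction.\<close>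

definition far_from :: "nat \<Rightarrow> nat \<Rightarrow> (nat \<Rightarrow> nat) \<Rightarrow> nat \<Rightarrow> nat set" where
  "far_from n w d v = {z. z < n \<and> (d z + w < v \<or> v + w < d z)}"

text \<open>Collapses the levels \<open>c\<close> and \<open>Suc c\<close> to \<open>c\<close> and
  closes the gap above them.\<close>

definition merge_level :: "nat \<Rightarrow> nat \<Rightarrow> nat" where
  "merge_level c v = (if v \<le> c then v else v - 1)"

lemma level_fun_comp:
  assumes "level_fun n p d" "mono_on {..<p} m" "m ` {..<p} = {..<q}"
  shows "level_fun n q (m \<circ> d)"
proof -
  have "d x < p" if "x < n" for x using assms(1) that unfolding level_fun_def by blast
  then have "mono_on {..<n} (m \<circ> d)"
    using assms(1,2) unfolding level_fun_def mono_on_def by simp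
  moreover have "(m \<circ> d) ` {..<n} = {..<q}"
    using assms(1,3) unfolding level_fun_def image_comp[symmetric] by simp
  ultimately show ?thesis by (simp add: level_fun_def)
qed

lemma level_fun_merge:
  assumes "level_fun n (Suc p) d" "c < p"
  shows "level_fun n p (merge_level c \<circ> d)"
proof (rule level_fun_comp[OF assms(1)])
  show "mono_on {..<Suc p} (merge_level c)" by (auto simp: mono_on_def merge_level_def)
  show "merge_level c ` {..<Suc p} = {..<p}"
  proof (intro equalityI subsetI)
    fix v assume "v \<in> {..<p}"
    then have "v = merge_level c (if v \<le> c then v else Suc v)" "(if v \<le> c then v else Suc v) < Suc p"
      by (auto simp: merge_level_def)
    then show "v \<in> merge_level c ` {..<Suc p}" by blast
  qed (use assms(2) in \<open>auto simp: merge_level_def split: if_splits\<close>)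
qed

text \<open>Levels \<open>2 * v\<close> and \<open>2 * v + 1\<close> form a pair; the
  \<open>min\<close> sends a leftover last level, present when \<open>p\<close> is odd, into the
  last pair.\<close>

lemma level_fun_pairs:
  assumes "level_fun n p d" "2 \<le> p"
  shows "level_fun n (p div 2) ((\<lambda>v. min (v div 2) (p div 2 - 1)) \<circ> d)"
proof (rule level_fun_comp[OF assms(1)])
  show "mono_on {..<p} (\<lambda>v. min (v div 2) (p div 2 - 1))"
    by (auto simp: mono_on_def intro: div_le_mono min.coboundedI1)
  show "(\<lambda>v. min (v div 2) (p div 2 - 1)) ` {..<p} = {..<p div 2}"
  proof (intro equalityI subsetI)
    fix v assume "v \<in> {..<p div 2}"
    then have "v = min (2 * v div 2) (p div 2 - 1)" "2 * v < p" by auto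
    then show "v \<in> (\<lambda>v. min (v div 2) (p div 2 - 1)) ` {..<p}" by blast
  qed (use assms(2) in auto)
qed

lemma convex_nat_set:
  fixes X :: "nat set"
  assumes "finite X" "X \<noteq> {}" "\<And>x y z. x \<in> X \<Longrightarrow> z \<in> X \<Longrightarrow> x \<le> y \<Longrightarrow> y \<le> z \<Longrightarrow> y \<in> X"
  shows "X = {Min X..Max X}"
proof
  show "X \<subseteq> {Min X..Max X}" using assms(1) by auto
  show "{Min X..Max X} \<subseteq> X"
    using assms(3)[OF Min_in[OF assms(1,2)] Max_in[OF assms(1,2)]] by (meson atLeastAtMost_iff subsetI)
qed

lemma level_nonempty:
  assumes "level_fun n p d" "v < p"
  shows "level n d v \<noteq> {}"
proof -
  have "v \<in> d ` {..<n}" using assms by (simp add: level_fun_def)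
  then show ?thesis by (auto simp: level_def)
qed

lemma level_less:
  assumes "level_fun n p d" "x \<in> level n d u" "y \<in> level n d v" "u < v"
  shows "x < y"
proof (rule ccontr)
  assume "\<not> x < y"
  then have "d y \<le> d x"
    using assms by (intro mono_onD[of "{..<n}" d]) (auto simp: level_def level_fun_def)
  then show False using assms by (simp add: level_def)
qed

lemma level_convex:
  assumes "level_fun n p d" "x < n" "z < n" "x \<le> y" "y \<le> z"
  shows "d x \<le> d y" "d y \<le> d z"
  using assms by (auto simp: level_fun_def mono_on_def)

lemma ordered_parts_levels:
  assumes "level_fun n p d"
  shows "ordered_parts (map (level n d) [0..<p])"
proof -
  have "\<exists>a b. level n d v = {a..b}" if "v < p" for v
  proof -
    have conv: "y \<in> level n d v" if "x \<in> level n d v" "z \<in> level n d v" "x \<le> y" "y \<le> z" for x y z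
      using level_convex[OF assms, of x z y] that by (auto simp: level_def)
    then have "level n d v = {Min (level n d v)..Max (level n d v)}"
      by (intro convex_nat_set[OF _ level_nonempty[OF assms that] conv]) (simp add: level_def)
    then show ?thesis by blast
  qed
  then show ?thesis
    unfolding ordered_parts_def
    by (auto simp: sorted_wrt_iff_nth_less intro: level_less[OF assms])
qed

lemma partition_on_levels:
  assumes "level_fun n p d"
  shows "partition_on {..<n} (set (map (level n d) [0..<p]))"
proof -
  have "d x < p" if "x < n" for x using assms that unfolding level_fun_def by blast
  then have "\<Union> (set (map (level n d) [0..<p])) = {..<n}"
    by (auto simp: level_def)
  moreover have "disjoint (set (map (level n d) [0..<p]))"
    by (auto simp: disjoint_def level_def)
  ultimately show ?thesis
    using level_nonempty[OF assms] unfolding partition_on_def by fastforce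
qed

lemma window_levels:
  "window (map (level n d) [0..<p]) k j = {x. x < n \<and> j \<le> d x \<and> d x < j + k \<and> d x < p}"
proof -
  have "take k (drop j [0..<p]) = [j..<min (j + k) p]"
    by (cases "j + k \<le> p") (auto simp: drop_upt take_upt min_def)
  then show ?thesis by (auto simp: window_def drop_map take_map level_def)
qed

section \<open>Distinct rows away from the diagonal\<close>

lemma distinct_rows_subset:
  assumes "finite X'" "X \<subseteq> X'" "Y \<subseteq> Y'"
  shows "distinct_rows M X Y \<le> distinct_rows M X' Y'"
proof -
  have "distinct_rows M X Y \<le> distinct_rows M X' Y"
    unfolding distinct_rows_def using assms by (intro card_mono image_mono) auto
  then show ?thesis using distinct_rows_mono[OF assms(1,3)] order_trans by blast
qed

text \<open>The invariant of the merging process. Here \<open>v\<close> ranges over all numbers: an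
  unoccupied level is empty and has no rows to count.\<close>

definition few_rows :: "'a mat \<Rightarrow> nat \<Rightarrow> nat \<Rightarrow> nat \<Rightarrow> (nat \<Rightarrow> nat) \<Rightarrow> bool" where
  "few_rows M n k w d \<longleftrightarrow> (\<forall>v. distinct_rows M (level n d v) (far_from n w d v) < k)"

text \<open>Any level other than the merged one is an old level, and merging never increases
  distances between levels, so its set of far columns can only shrink. Thus only level
  \<open>c\<close> has to be checked.\<close>

lemma merge_preserves_few_rows:
  assumes few: "few_rows M n k w d"
    and c: "distinct_rows M (level n (merge_level c \<circ> d) c) (far_from n w (merge_level c \<circ> d) c) < k"
  shows "few_rows M n k w (merge_level c \<circ> d)"
  unfolding few_rows_def
proof
  fix v
  show "distinct_rows M (level n (merge_level c \<circ> d) v) (far_from n w (merge_level c \<circ> d) v) < k"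
  proof (cases "v = c")
    case False
    \<comment> \<open>The old level that \<open>merge_level c\<close> sends to \<open>v\<close>,
      unique since \<open>v\<close> differs from \<open>c\<close>.\<close>
    define u where "u = (if v < c then v else Suc v)"
    have "level n (merge_level c \<circ> d) v \<subseteq> level n d u"
      using False by (auto simp: level_def merge_level_def u_def split: if_splits)
    moreover have "far_from n w (merge_level c \<circ> d) v \<subseteq> far_from n w d u"
      using False by (auto simp: far_from_def merge_level_def u_def split: if_splits)
    ultimately have "distinct_rows M (level n (merge_level c \<circ> d) v) (far_from n w (merge_level c \<circ> d) v)
        \<le> distinct_rows M (level n d u) (far_from n w d u)"
      by (intro distinct_rows_subset) (auto simp: level_def)
    then show ?thesis using few by (meson few_rows_def order_le_less_trans)
  qed (use c in simp)
qed

lemma few_rows_id: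
  assumes "2 \<le> k"
  shows "few_rows M n k w (\<lambda>x. x)"
  unfolding few_rows_def
proof
  fix v
  have "level n (\<lambda>x. x) v \<subseteq> {v}" by (auto simp: level_def)
  then have "distinct_rows M (level n (\<lambda>x. x) v) (far_from n w (\<lambda>x. x) v)
      \<le> distinct_rows M {v} (far_from n w (\<lambda>x. x) v)"
    by (intro distinct_rows_subset) auto
  then show "distinct_rows M (level n (\<lambda>x. x) v) (far_from n w (\<lambda>x. x) v) < k"
    using assms by (simp add: distinct_rows_def)
qed

lemma symmetric_entry:
  assumes "M \<in> carrier_mat n n" "transpose_mat M = M" "x < n" "y < n"
  shows "M $$ (x, y) = M $$ (y, x)"
  using assms by (metis carrier_matD index_transpose_mat(1))

lemma distinct_cols_eq_rows:
  assumes "M \<in> carrier_mat n n" "transpose_mat M = M" "X \<subseteq> {..<n}" "Y \<subseteq> {..<n}"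
  shows "distinct_cols M X Y = distinct_rows M Y X"
proof -
  have "(\<lambda>j. \<lambda>i\<in>X. M $$ (i, j)) ` Y = (\<lambda>i. \<lambda>j\<in>X. M $$ (i, j)) ` Y"
    using assms by (intro image_cong restrict_ext) (auto intro!: symmetric_entry[OF assms(1,2)])
  then show ?thesis by (simp add: distinct_cols_def distinct_rows_def)
qed

text \<open>If no merge of adjacent parts is possible, pair up the parts; when the number of parts is
  odd, the last part becomes a triple, which is why \<open>2 k - 1\<close> rather than \<open>2 k - 2\<close> levels
  are ignored on each side.\<close>

lemma mergeable_or_wide:
  assumes M: "M \<in> carrier_mat n n" "transpose_mat M = M"
    and d: "level_fun n (Suc p) d" and "1 \<le> p" and few: "few_rows M n k (2 * k - 1) d"
    and no_wide: "\<not> (\<exists>Rs Cs. wide_division M k Rs Cs)"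
  obtains c where "c < p" "few_rows M n k (2 * k - 1) (merge_level c \<circ> d)"
proof (rule ccontr)
  note witness = that
  assume "\<not> thesis"
  then have "\<not> few_rows M n k (2 * k - 1) (merge_level c \<circ> d)" if "c < p" for c
    using witness that by blast
  \<comment> \<open>A merge can violate the invariant only at the merged level, so each failure
    exhibits \<open>k\<close> distinct far rows exactly there.\<close>
  then have stuck: "k \<le> distinct_rows M (level n (merge_level c \<circ> d) c)
      (far_from n (2 * k - 1) (merge_level c \<circ> d) c)" if "c < p" for c
    using that merge_preserves_few_rows[OF few] linorder_not_le by blast
  define q where "q = Suc p div 2"
  define e where "e = (\<lambda>v. min (v div 2) (q - 1)) \<circ> d"
  define Rs where "Rs = map (level n e) [0..<q]"
  have e: "level_fun n q e"
    unfolding e_def q_def using level_fun_pairs[OF d] assms(4) by simp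
  have "symmetric_partition M (set Rs, set Rs)"
    using partition_on_levels[OF e] M by (auto simp: symmetric_partition_def Rs_def)
  then have "division M Rs Rs"
    using ordered_parts_levels[OF e] by (simp add: division_def Rs_def)
  moreover have row: "row_wide M k Rs Rs i" if i: "i < q" for i
    unfolding row_wide_def
  proof (intro allI impI)
    fix j assume j: "j \<le> i \<and> i < j + k"
    \<comment> \<open>Pair \<open>i\<close> contains both levels \<open>2 * i\<close> and
      \<open>2 * i + 1\<close>, so the failed merge of these two supplies its distinct rows.\<close>
    have "2 * i < p" using i by (simp add: q_def)
    from stuck[OF this] have "k \<le> distinct_rows M (level n (merge_level (2 * i) \<circ> d) (2 * i))
      (far_from n (2 * k - 1) (merge_level (2 * i) \<circ> d) (2 * i))" .
    also have "\<dots> \<le> distinct_rows M (level n e i) ({..<n} - window Rs k j)"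
    proof (rule distinct_rows_subset)
      show "level n (merge_level (2 * i) \<circ> d) (2 * i) \<subseteq> level n e i"
        using i by (auto simp: level_def merge_level_def e_def split: if_splits)
      have "x \<notin> window Rs k j"
        if x: "x \<in> far_from n (2 * k - 1) (merge_level (2 * i) \<circ> d) (2 * i)" for x
      proof
        assume "x \<in> window Rs k j"
        then have xw: "x < n" "j \<le> e x" "e x < j + k"
          unfolding Rs_def window_levels by auto
        have "d x < Suc p" using d xw(1) unfolding level_fun_def by blast
        \<comment> \<open>The slack 2 instead of 1 is due to a possible final triple. At the upper
          end of the window \<open>e x \<le> i + k - 1\<close>, hence
          \<open>d x \<le> 2 * i + 2 * k\<close>, which is level \<open>2 * i + (2 * k - 1)\<close>
          after the merge: just not far.\<close>
        then have "2 * e x \<le> d x" "d x \<le> 2 * e x + 2"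
          unfolding e_def q_def by (auto simp: min_def)
        moreover have "e x + 1 \<le> i + k" "i + 1 \<le> e x + k" using j xw by auto
        ultimately show False
          using x by (auto simp: far_from_def merge_level_def split: if_splits)
      qed
      then show "far_from n (2 * k - 1) (merge_level (2 * i) \<circ> d) (2 * i) \<subseteq> {..<n} - window Rs k j"
        by (auto simp: far_from_def)
    qed (simp add: level_def)
    finally show "k \<le> distinct_rows M (Rs ! i) ({..<dim_col M} - window Rs k j)"
      using i M by (simp add: Rs_def)
  qed
  moreover have "col_wide M k Rs Rs i" if i: "i < q" for i
  proof -
    have "distinct_cols M ({..<n} - window Rs k j) (Rs ! i)
        = distinct_rows M (Rs ! i) ({..<n} - window Rs k j)" for j
      using i by (intro distinct_cols_eq_rows[OF M]) (auto simp: Rs_def level_def)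
    then show ?thesis using row[OF i] M by (simp add: row_wide_def col_wide_def)
  qed
  ultimately have "wide_division M k Rs Rs" by (simp add: wide_division_def Rs_def)
  then show False using no_wide by blast
qed

section \<open>Classes of rows that agree away from the diagonal\<close>

text \<open>The level is a component of the key so that no class straddles two parts of the
  division.\<close>

definition row_key :: "'a mat \<Rightarrow> nat \<Rightarrow> nat \<Rightarrow> (nat \<Rightarrow> nat) \<Rightarrow> nat \<Rightarrow> nat \<times> (nat \<Rightarrow> 'a)" where
  "row_key M n w d x = (d x, \<lambda>z\<in>far_from n w d (d x). M $$ (x, z))"

definition row_classes :: "'a mat \<Rightarrow> nat \<Rightarrow> nat \<Rightarrow> (nat \<Rightarrow> nat) \<Rightarrow> parts" where
  "row_classes M n w d =
     (\<lambda>x. {y. y < n \<and> row_key M n w d y = row_key M n w d x}) ` {..<n}"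

lemma row_key_eq_iff:
  "row_key M n w d x = row_key M n w d y \<longleftrightarrow>
     d x = d y \<and> (\<forall>z\<in>far_from n w d (d y). M $$ (x, z) = M $$ (y, z))"
  by (auto simp: row_key_def restrict_def fun_eq_iff)

lemma partition_on_row_classes: "partition_on {..<n} (row_classes M n w d)"
  unfolding partition_on_def disjoint_def row_classes_def by auto

lemma refines_row_classesD:
  assumes "refines {..<n} Q (row_classes M n w d)" "Z \<in> Q" "x \<in> Z" "y \<in> Z"
  shows "x < n" "row_key M n w d x = row_key M n w d y" "d x = d y"
proof -
  obtain Y where "Y \<in> row_classes M n w d" "x \<in> Y" "y \<in> Y"
    using assms unfolding refines_def by blast
  then show "x < n" "row_key M n w d x = row_key M n w d y"
    by (auto simp: row_classes_def)
  then show "d x = d y" by (simp add: row_key_def)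
qed

text \<open>Merging levels shrinks the set of far columns, so rows that agreed on the old set still
  agree on the new one.\<close>

lemma row_classes_refines_merge:
  "refines {..<n} (row_classes M n w d) (row_classes M n w (merge_level c \<circ> d))"
  (is "refines _ ?P ?Q")
proof -
  have key: "row_key M n w (merge_level c \<circ> d) y = row_key M n w (merge_level c \<circ> d) x"
    if "row_key M n w d y = row_key M n w d x" for x y
  proof -
    have "far_from n w (merge_level c \<circ> d) ((merge_level c \<circ> d) x) \<subseteq> far_from n w d (d x)"
      by (auto simp: far_from_def merge_level_def split: if_splits)
    then show ?thesis using that unfolding row_key_eq_iff by auto
  qed
  have "\<exists>Y\<in>?Q. X \<subseteq> Y" if X: "X \<in> ?P" for X
  proof -
    obtain x where x: "x < n" "X = {y. y < n \<and> row_key M n w d y = row_key M n w d x}"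
      using X unfolding row_classes_def by blast
    let ?Y = "{y. y < n \<and> row_key M n w (merge_level c \<circ> d) y = row_key M n w (merge_level c \<circ> d) x}"
    have "?Y \<in> ?Q" using x(1) unfolding row_classes_def by blast
    moreover have "X \<subseteq> ?Y" using key unfolding x(2) by blast
    ultimately show ?thesis by blast
  qed
  then show ?thesis using partition_on_row_classes by (auto simp: refines_def)
qed

text \<open>The starting point of the sequence: each index is alone on its level.\<close>

lemma row_classes_id: "row_classes M n w (\<lambda>x. x) = (\<lambda>x. {x}) ` {..<n}"
  unfolding row_classes_def by (intro image_cong) (auto simp: row_key_eq_iff)

text \<open>The end point of the sequence: with one level no column is far, so all keys
  coincide.\<close>

lemma row_classes_one_level:
  assumes "level_fun n 1 d"
  shows "row_classes M n w d = {{..<n}}"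
proof -
  have d: "d x = 0" if "x < n" for x using assms that unfolding level_fun_def by blast
  have "{..<n} \<noteq> {}" using assms by (auto simp: level_fun_def)
  moreover have "{y. y < n \<and> row_key M n w d y = row_key M n w d x} = {..<n}" if "x < n" for x
    using d that by (auto simp: row_key_eq_iff far_from_def)
  ultimately show ?thesis unfolding row_classes_def by auto
qed

text \<open>A class on level \<open>v\<close> is determined by the far part of any of its rows, and
  \<open>few_rows\<close> bounds the number of such far parts.\<close>

lemma card_row_classes_level:
  assumes "few_rows M n k w d"
  shows "card {X \<in> row_classes M n w d. \<exists>x\<in>X. d x = v} \<le> k"
proof -
  let ?f = "\<lambda>r. {y. y < n \<and> row_key M n w d y = (v, r)}"
  let ?R = "(\<lambda>x. \<lambda>z\<in>far_from n w d v. M $$ (x, z)) ` level n d v"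
  have "{X \<in> row_classes M n w d. \<exists>x\<in>X. d x = v} \<subseteq> ?f ` ?R"
    by (force simp: row_classes_def row_key_def level_def)
  then have "card {X \<in> row_classes M n w d. \<exists>x\<in>X. d x = v} \<le> card (?f ` ?R)"
    by (rule card_mono[rotated]) (simp add: level_def)
  also have "\<dots> \<le> card ?R" by (rule card_image_le) (simp add: level_def)
  also have "\<dots> \<le> k" using assms by (simp add: few_rows_def distinct_rows_def less_imp_le)
  finally show ?thesis .
qed

text \<open>Each counted part of \<open>Q\<close> contains a class of \<open>d\<close> that meets a
  level in \<open>V\<close>; there are at most \<open>k\<close> such classes per level.\<close>

lemma card_parts_levels:
  assumes few: "few_rows M n k w d" and ref: "refines {..<n} (row_classes M n w d) Q"
    and V: "finite V"
  shows "card {Y \<in> Q. \<exists>y\<in>Y. d y \<in> V} \<le> card V * k"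
proof -
  let ?P = "row_classes M n w d"
  let ?S = "\<Union>v\<in>V. {X \<in> ?P. \<exists>x\<in>X. d x = v}"
  have P: "partition_on {..<n} ?P" and Q: "partition_on {..<n} Q"
    and sub: "\<And>X. X \<in> ?P \<Longrightarrow> \<exists>Y\<in>Q. X \<subseteq> Y"
    using ref by (auto simp: refines_def)
  have fin: "finite ?P" by (simp add: row_classes_def)
  \<comment> \<open>Sends a class to the part of \<open>Q\<close> containing it; on the classes
    meeting \<open>V\<close> its image covers all counted parts.\<close>
  let ?g = "\<lambda>X. THE Y. Y \<in> Q \<and> X \<subseteq> Y"
  have "{Y \<in> Q. \<exists>y\<in>Y. d y \<in> V} \<subseteq> ?g ` ?S"
  proof
    fix Y assume "Y \<in> {Y \<in> Q. \<exists>y\<in>Y. d y \<in> V}"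
    then obtain y where y: "Y \<in> Q" "y \<in> Y" "d y \<in> V" by blast
    have "y \<in> \<Union> ?P" using y partition_onD1[OF P] partition_onD1[OF Q] by blast
    then obtain X where X: "X \<in> ?P" "y \<in> X" by blast
    have uniq: "Y' = Y" if "Y' \<in> Q" "X \<subseteq> Y'" for Y'
      using partition_on_part_eq[OF Q that(1) y(1)] that(2) X(2) y(2) by blast
    then have "X \<subseteq> Y" using sub[OF X(1)] by blast
    then have "?g X = Y" using y(1) uniq by (intro the_equality) blast+
    moreover have "X \<in> ?S" using X y by blast
    ultimately show "Y \<in> ?g ` ?S" by blast
  qed
  moreover have "finite ?S" using fin V by auto
  ultimately have "card {Y \<in> Q. \<exists>y\<in>Y. d y \<in> V} \<le> card ?S"
    by (meson card_image_le card_mono finite_imageI order_trans)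
  also have "\<dots> \<le> (\<Sum>v\<in>V. card {X \<in> ?P. \<exists>x\<in>X. d x = v})" by (rule card_UN_le[OF V])
  also have "\<dots> \<le> card V * k"
    using sum_bounded_above[of V _ k] card_row_classes_level[OF few] by simp
  finally show ?thesis .
qed

section \<open>Stretch of the intermediate partitions\<close>

text \<open>If the levels were far apart, rows \<open>i\<close> and \<open>i'\<close> would agree in
  the far column \<open>j\<close>. By symmetry columns \<open>j\<close> and \<open>j'\<close> may be
  read as rows, and these agree in the far column \<open>i'\<close>. Hence the zone would be
  constant.\<close>

lemma nonconstant_zone_near:
  assumes M: "M \<in> carrier_mat n n" "transpose_mat M = M"
    and Q: "refines {..<n} Q (row_classes M n w d)"
    and XY: "X \<in> Q" "Y \<in> Q" "nonconstant_zone M X Y" and xy: "x \<in> X" "y \<in> Y"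
  shows "d y \<le> d x + w" "d x \<le> d y + w"
proof -
  have part: "x' < n \<and> row_key M n w d x' = row_key M n w d x''"
    if "Z \<in> Q" "x' \<in> Z" "x'' \<in> Z" for Z x' x''
    using refines_row_classesD[OF Q] that by blast
  have "\<not> (d x + w < d y \<or> d y + w < d x)"
  proof
    assume far: "d x + w < d y \<or> d y + w < d x"
    obtain i j i' j' where ij: "i \<in> X" "j \<in> Y" "i' \<in> X" "j' \<in> Y" "M $$ (i, j) \<noteq> M $$ (i', j')"
      using XY(3) unfolding nonconstant_zone_def by blast
    have n: "i < n" "j < n" "i' < n" "j' < n" using part XY(1,2) ij by blast+
    have lev: "d i = d x" "d i' = d x" "d j = d y" "d j' = d y"
      using refines_row_classesD(3)[OF Q] XY(1,2) ij xy by blast+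
    have "M $$ (i, j) = M $$ (i', j)"
      using part[OF XY(1) ij(1,3)] n lev far by (auto simp: row_key_eq_iff far_from_def)
    also have "\<dots> = M $$ (j, i')" using symmetric_entry[OF M] n by blast
    also have "\<dots> = M $$ (j', i')"
      using part[OF XY(2) ij(2,4)] n lev far by (auto simp: row_key_eq_iff far_from_def)
    also have "\<dots> = M $$ (i', j')" using symmetric_entry[OF M] n by blast
    finally show False using ij(5) by blast
  qed
  then show "d y \<le> d x + w" "d x \<le> d y + w" by auto
qed

text \<open>Both neighbours of \<open>Q\<close> are used: the coarser classes, of the merged level
  function, confine the conflicting parts to a band of levels, while the finer classes, of
  \<open>d\<close>, bound the number of parts meeting that band.\<close>

lemma row_stretch_le:
  assumes M: "M \<in> carrier_mat n n" "transpose_mat M = M"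
    and d: "level_fun n p (merge_level c \<circ> d)" and few: "few_rows M n k w d"
    and PQ: "refines {..<n} (row_classes M n w d) Q"
    and QP: "refines {..<n} Q (row_classes M n w (merge_level c \<circ> d))"
    and X: "X \<in> Q"
  shows "row_stretch M Q X \<le> (2 * w + 2) * k"
proof -
  define e where "e = merge_level c \<circ> d"
  have Q: "partition_on {..<n} Q" using QP by (simp add: refines_def)
  have Qn: "Y \<subseteq> {..<n}" "Y \<noteq> {}" "finite Y" if "Y \<in> Q" for Y
  proof -
    show "Y \<subseteq> {..<n}" using Q that by (auto simp: partition_on_def)
    then show "finite Y" by (rule finite_subset) simp
    show "Y \<noteq> {}" using Q that by (auto simp: partition_on_def)
  qed
  obtain x where x: "x \<in> X" using Qn(2)[OF X] by blast
  have same: "e y = e y'" if "Y \<in> Q" "y \<in> Y" "y' \<in> Y" for Y y y'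
    using refines_row_classesD(3)[OF QP that] by (simp add: e_def)
  define U where "U = \<Union>{Z \<in> Q. Z = X \<or> nonconstant_zone M X Z}"
  have U: "e u \<le> e x + w" "e x \<le> e u + w" "u < n" if u: "u \<in> U" for u
  proof -
    obtain Z where Z: "Z \<in> Q" "Z = X \<or> nonconstant_zone M X Z" "u \<in> Z"
      using u unfolding U_def by blast
    show "e u \<le> e x + w" "e x \<le> e u + w"
      using Z same[OF X x] nonconstant_zone_near[OF M QP X Z(1) _ x Z(3)] unfolding e_def[symmetric]
      by (auto simp: le_add1)
    show "u < n" using Qn Z by blast
  qed
  have Une: "U \<noteq> {}" "finite U"
  proof -
    show "U \<noteq> {}" using X x unfolding U_def by blast
    have "U \<subseteq> {..<n}" using U(3) by blast
    then show "finite U" by (rule finite_subset) simp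
  qed
  \<comment> \<open>The levels of \<open>d\<close> lying over the \<open>2 * w + 1\<close> merged
    levels around \<open>e x\<close>. Two levels may collapse to one, so one more level has to be
    allowed, giving \<open>2 * w + 2\<close>.\<close>
  define V where "V = {v. e x \<le> merge_level c v + w \<and> merge_level c v \<le> e x + w}"
  have V: "V \<subseteq> {e x - w..e x + w + 1}"
    unfolding V_def by (auto simp: merge_level_def split: if_splits)
  have "{Y \<in> Q. in_conflict Y U} \<subseteq> {Y \<in> Q. \<exists>y\<in>Y. d y \<in> V}"
  proof (clarsimp)
    fix Y assume Y: "Y \<in> Q" "in_conflict Y U"
    then obtain t where t: "Min Y \<le> t" "t \<le> Max Y" "Min U \<le> t" "t \<le> Max U"
      unfolding in_conflict_def span_of_def by (metis IntE atLeastAtMost_iff ex_in_conv)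
    have YM: "Min Y \<in> Y" "Max Y \<in> Y" using Qn[OF Y(1)] by auto
    have UM: "Min U \<in> U" "Max U \<in> U" using Une by auto
    \<comment> \<open>The common point \<open>t\<close> of the spans need not belong to
      \<open>Y\<close>, but \<open>e\<close> is monotone and takes equal values at both ends of
      \<open>Y\<close>, so \<open>t\<close> lies on the level of \<open>Y\<close>. Likewise its
      level is between those of the ends of \<open>U\<close>.\<close>
    have "e (Min Y) \<le> e t" "e t \<le> e (Max Y)"
      using level_convex[OF d, of "Min Y" "Max Y" t] t YM Qn(1)[OF Y(1)] by (auto simp: e_def)
    moreover have "e (Min Y) = e (Max Y)" using same[OF Y(1)] YM by blast
    moreover have "e (Min U) \<le> e t" "e t \<le> e (Max U)"
      using level_convex[OF d, of "Min U" "Max U" t] t U(3) UM by (auto simp: e_def)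
    ultimately have "e x \<le> e (Min Y) + w" "e (Min Y) \<le> e x + w"
      using U(1)[OF UM(2)] U(2)[OF UM(1)] by linarith+
    then show "\<exists>y\<in>Y. d y \<in> V" using YM(1) unfolding V_def e_def by auto
  qed
  moreover have "finite Q" by (rule finite_elements[OF _ Q]) simp
  ultimately have "row_stretch M Q X \<le> card {Y \<in> Q. \<exists>y\<in>Y. d y \<in> V}"
    unfolding row_stretch_def U_def by (intro card_mono) auto
  also have "\<dots> \<le> card V * k"
    using card_parts_levels[OF few PQ] V finite_subset by blast
  also have "card V \<le> 2 * w + 2"
    using card_mono[OF _ V] by simp
  finally show ?thesis by (simp add: mult_le_mono1)
qed

lemma col_stretch_eq_row_stretch:
  assumes M: "M \<in> carrier_mat n n" "transpose_mat M = M"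
    and Q: "partition_on {..<n} Q" and "X \<in> Q"
  shows "col_stretch M Q X = row_stretch M Q X"
proof -
  have "nonconstant_zone M Z X \<longleftrightarrow> nonconstant_zone M X Z" if "Z \<in> Q" for Z
  proof -
    have "i < n" if "i \<in> Z \<or> i \<in> X" for i using Q \<open>Z \<in> Q\<close> \<open>X \<in> Q\<close> that
      by (auto simp: partition_on_def)
    then have "M $$ (i, j) = M $$ (j, i)" if "i \<in> Z" "j \<in> X" for i j
      using symmetric_entry[OF M] that by blast
    then show ?thesis unfolding nonconstant_zone_def by metis
  qed
  then have "{Z \<in> Q. Z = X \<or> nonconstant_zone M Z X} = {Z \<in> Q. Z = X \<or> nonconstant_zone M X Z}"
    by blast
  then show ?thesis by (simp add: col_stretch_def row_stretch_def)
qed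

section \<open>Assembling the merge sequence and its bound\<close>

text \<open>The invariant of the whole sequence. For symmetric \<open>M\<close> a bound on row
  stretch also bounds the column stretch.\<close>

definition stretch_bounded :: "'a mat \<Rightarrow> nat \<Rightarrow> nat \<Rightarrow> parts \<Rightarrow> bool" where
  "stretch_bounded M n b Q \<longleftrightarrow>
     partition_on {..<n} Q \<and> (\<forall>X\<in>Q. row_stretch M Q X \<le> b)"

text \<open>Each merge of two adjacent levels is expanded into single merges between the two
  successive class partitions, and these paths are concatenated by induction on the number of
  levels.\<close>

lemma merge_path_to_one_part:
  assumes M: "M \<in> carrier_mat n n" "transpose_mat M = M" and k: "2 \<le> k"
    and no_wide: "\<not> (\<exists>Rs Cs. wide_division M k Rs Cs)"
    and "level_fun n (Suc p) d" "few_rows M n k (2 * k - 1) d"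
  shows "(\<lambda>T T'. merge_parts T T' \<and> stretch_bounded M n (4 * k * k) T
      \<and> stretch_bounded M n (4 * k * k) T')\<^sup>*\<^sup>* (row_classes M n (2 * k - 1) d) {{..<n}}"
  using assms(5,6)
proof (induction p arbitrary: d)
  case 0
  then show ?case by (simp add: row_classes_one_level)
next
  case (Suc p)
  obtain c where c: "c < Suc p" "few_rows M n k (2 * k - 1) (merge_level c \<circ> d)"
    using mergeable_or_wide[OF M Suc.prems(1) _ Suc.prems(2) no_wide] by auto
  let ?w = "2 * k - 1"
  let ?e = "merge_level c \<circ> d"
  have e: "level_fun n (Suc p) ?e" by (rule level_fun_merge[OF Suc.prems(1) c(1)])
  have bounded: "stretch_bounded M n (4 * k * k) T"
    if "refines {..<n} (row_classes M n ?w d) T" "refines {..<n} T (row_classes M n ?w ?e)" for T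
  proof -
    have "2 * ?w + 2 = 4 * k" using k by auto
    then have "row_stretch M T X \<le> 4 * k * k" if "X \<in> T" for X
      using row_stretch_le[OF M e Suc.prems(2) \<open>refines _ _ T\<close> \<open>refines _ T _\<close> that] by simp
    then show ?thesis using that by (simp add: stretch_bounded_def refines_def)
  qed
  show ?case
    using refines_merge_path[OF finite_lessThan row_classes_refines_merge bounded] Suc.IH[OF e c(2)]
    by (rule rtranclp_trans)
qed

theorem theorem22:
  fixes M :: "'a::zero_neq_one mat" and n k :: nat
  assumes "M \<in> carrier_mat n n"
    and "zero_one_matrix M"
    and "transpose_mat M = M"
    and "\<not> (\<exists>Rs Cs. wide_division M k Rs Cs)"
  shows "stw M \<le> 32 * (k + 1) ^ 3"
proof -
  note M = assms(1,3)
  have dim: "dim_row M = n" "dim_col M = n" using assms(1) by auto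
  \<comment> \<open>For the empty matrix the empty division is vacuously wide.\<close>
  have n: "n > 0"
  proof (rule ccontr)
    assume "\<not> n > 0"
    then have "wide_division M k [] []"
      using dim by (simp add: wide_division_def division_def symmetric_partition_def
          ordered_parts_def partition_on_def)
    then show False using assms(4) by blast
  qed
  have id: "level_fun n (Suc (n - 1)) (\<lambda>x. x)"
    using n by (simp add: level_fun_def mono_on_def)
  \<comment> \<open>For \<open>k \<le> 1\<close> the division into singletons is wide: a single row
    restricted to any columns, even none, counts as one distinct row.\<close>
  have k: "2 \<le> k"
  proof (rule ccontr)
    assume "\<not> 2 \<le> k"
    let ?Rs = "map (level n (\<lambda>x. x)) [0..<n]"
    have "division M ?Rs ?Rs"
      using partition_on_levels[OF id] ordered_parts_levels[OF id] n dim
      by (simp add: division_def symmetric_partition_def)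
    moreover have "k \<le> distinct_rows M (level n (\<lambda>x. x) i) Y"
      and "k \<le> distinct_cols M Y (level n (\<lambda>x. x) i)" if "i < n" for i Y
    proof -
      have "level n (\<lambda>x. x) i = {i}" using that by (auto simp: level_def)
      then show "k \<le> distinct_rows M (level n (\<lambda>x. x) i) Y"
        "k \<le> distinct_cols M Y (level n (\<lambda>x. x) i)"
        using \<open>\<not> 2 \<le> k\<close> by (simp_all add: distinct_rows_def distinct_cols_def)
    qed
    ultimately have "wide_division M k ?Rs ?Rs"
      by (simp add: wide_division_def row_wide_def col_wide_def)
    then show False using assms(4) by blast
  qed
  define b where "b = 4 * k * k"
  have one: "stretch_bounded M n b {{..<n}}"
  proof -
    have "row_stretch M {{..<n}} X \<le> card {{..<n}}" for X
      unfolding row_stretch_def by (intro card_mono) auto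
    then have "row_stretch M {{..<n}} X \<le> 4 * k * k" for X
      using k by (intro order_trans[OF \<open>row_stretch M {{..<n}} X \<le> _\<close>]) simp
    then show ?thesis
      using n by (auto simp: stretch_bounded_def b_def partition_on_def disjoint_def)
  qed
  have path: "(\<lambda>T T'. merge_parts T T' \<and> stretch_bounded M n b T \<and> stretch_bounded M n b T')\<^sup>*\<^sup>*
      ((\<lambda>x. {x}) ` {..<n}) {{..<n}}"
    using merge_path_to_one_part[OF M k assms(4) id few_rows_id[OF k]]
    unfolding row_classes_id b_def .
  obtain Ps where Ps: "Ps \<noteq> []" "hd Ps = (\<lambda>x. {x}) ` {..<n}" "last Ps = {{..<n}}"
      "successively merge_parts Ps" "\<forall>Q\<in>set Ps. stretch_bounded M n b Q"
    by (rule rtranclp_successively_list[OF path one])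
  \<comment> \<open>Using each partition for both rows and columns makes every one-sided merge a
    symmetric merge step.\<close>
  define S where "S = map (\<lambda>Q. (Q, Q)) Ps"
  have "symmetric_partition M P" if "P \<in> set S" for P
    using that Ps(5) dim by (auto simp: S_def symmetric_partition_def stretch_bounded_def)
  moreover have "successively merge_step S"
    using Ps(4) unfolding S_def successively_map
    by (rule successively_mono) (auto simp: merge_parts_def merge_step_def)
  ultimately have seq: "symmetric_partition_sequence M S"
    using Ps(1-3) dim by (simp add: symmetric_partition_sequence_def S_def hd_map last_map)
  have "stretch_value M P \<le> b" if P: "P \<in> set S" for P
  proof -
    obtain Q where Q: "P = (Q, Q)" "stretch_bounded M n b Q"
      using P Ps(5) by (auto simp: S_def)
    then have part: "partition_on {..<n} Q" by (simp add: stretch_bounded_def)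
    have "finite Q" by (rule finite_elements[OF _ part]) simp
    moreover have "Q \<noteq> {}" using part n by (auto simp: partition_on_def)
    ultimately show ?thesis
      using Q(2) col_stretch_eq_row_stretch[OF M part]
      by (simp add: Q(1) stretch_value_def stretch_bounded_def ball_Un)
  qed
  then have "Max (stretch_value M ` set S) \<le> b"
    using Ps(1) by (simp add: S_def)
  moreover have "stw M \<le> Max (stretch_value M ` set S)"
    unfolding stw_def using seq by (intro cINF_lower) auto
  moreover have "b \<le> 32 * (k + 1) ^ 3"
    by (simp add: b_def power3_eq_cube algebra_simps)
  ultimately show ?thesis by linarith
qed

end
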